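(* Let $\mu$ be a self-similar measure that satisfies the strong separation condition. For any dimension function $\Phi$ we have $$\underline{\dim}_\Phi\mu=\min\{\dim_{\mathrm{loc}}\mu(z):z\in\mathrm{supp}\,\mu\}\quad\text{and}\quad \overline{\dim}_\Phi\mu=\max\{\dim_{\mathrm{loc}}\mu(z):z\in\mathrm{supp}\,\mu\}.$$
   Context: Let $X$ be a complete metric space and $S_j:X\to X$, $j=0,\dots,m$ ($m\ge1$), similarities with contraction factors $r_j$, $0<|r_j|<1$ (an iterated function system, IFS), and let $p_j>0$ with $\sum_{j=0}^m p_j=1$. The associated self-similar set is the unique non-empty compact set $K$ with $K=\bigcup_{j=0}^m S_j(K)$, and the associated self-similar measure is the unique Borel probability measure $\mu$ with $\mu(E)=\sum_{j=0}^m p_j\,\mu(S_j^{-1}(E))$ for all Borel $E\subseteq X$; its support is $K$. The strong separation condition means that the sets $S_j(K)$, $j=0,\dots,m$, are pairwise disjoint. A dimension function is a map $\Phi:(0,1)\to[0,\infty)$ such that $x^{1+\Phi(x)}$ decreases to $0$ as $x$ decreases to $0$. With $B(x,R)$ the open ball, $\overline{\dim}_\Phi\mu$ is the infimum of all $\alpha$ for which there exist $C_1,C_2>0$ such that for all $0<r<R^{1+\Phi(R)}\le R\le C_1$ and all $x\in\mathrm{supp}\,\mu$, $\mu(B(x,R))/\mu(B(x,r))\le C_2(R/r)^\alpha$; $\underline{\dim}_\Phi\mu$ is the supremum of all $\alpha$ for which there exist $C_1,C_2>0$ such that for the same $r,R,x$, $\mu(B(x,R))/\mu(B(x,r))\ge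 C_2(R/r)^\alpha$. The local dimension of $\mu$ at $z$ is $\dim_{\mathrm{loc}}\mu(z)=\lim_{r\to0}\frac{\log\mu(B(z,r))}{\log r}$ when the limit exists; the sets of local dimensions are taken over those $z\in\mathrm{supp}\,\mu$ at which it exists. *)

theory Defs
  imports "HOL-Probability.Probability"
begin

text \<open>A contraction factor may be negative, as for \<open>x \<mapsto> r * x + b\<close> on the line; the
  metric sees only its absolute value.\<close>

definition similarity :: "real \<Rightarrow> ('a::metric_space \<Rightarrow> 'a) \<Rightarrow> bool" where
  "similarity c f \<longleftrightarrow> (\<forall>x y. dist (f x) (f y) = \<bar>c\<bar> * dist x y)"

definition ifs :: "nat \<Rightarrow> (nat \<Rightarrow> real) \<Rightarrow> (nat \<Rightarrow> 'a::complete_space \<Rightarrow> 'a) \<Rightarrow> bool" where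
  "ifs m r S \<longleftrightarrow> 1 \<le> m \<and> (\<forall>j\<le>m. 0 < \<bar>r j\<bar> \<and> \<bar>r j\<bar> < 1 \<and> similarity (r j) (S j))"

definition prob_weights :: "nat \<Rightarrow> (nat \<Rightarrow> real) \<Rightarrow> bool" where
  "prob_weights m p \<longleftrightarrow> (\<forall>j\<le>m. 0 < p j) \<and> (\<Sum>j\<le>m. p j) = 1"

text \<open>For an IFS on a complete space exactly one set \<open>K\<close> and, given the weights, exactly one
  measure \<open>\<mu>\<close> satisfy the following two predicates.\<close>

definition self_similar_set ::
    "nat \<Rightarrow> (nat \<Rightarrow> 'a::metric_space \<Rightarrow> 'a) \<Rightarrow> 'a set \<Rightarrow> bool" where
  "self_similar_set m S K \<longleftrightarrow> K \<noteq> {} \<and> compact K \<and> K = (\<Union>j\<le>m. S j ` K)"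

definition self_similar_measure ::
    "nat \<Rightarrow> (nat \<Rightarrow> 'a::metric_space \<Rightarrow> 'a) \<Rightarrow> (nat \<Rightarrow> real) \<Rightarrow> 'a measure \<Rightarrow> bool" where
  "self_similar_measure m S p \<mu> \<longleftrightarrow>
     prob_space \<mu> \<and> sets \<mu> = sets borel \<and>
     (\<forall>E\<in>sets borel. measure \<mu> E = (\<Sum>j\<le>m. p j * measure \<mu> (S j -` E)))"

definition strong_separation ::
    "nat \<Rightarrow> (nat \<Rightarrow> 'a \<Rightarrow> 'a) \<Rightarrow> 'a set \<Rightarrow> bool" where
  "strong_separation m S K \<longleftrightarrow> disjoint_family_on (\<lambda>j. S j ` K) {..m}"

definition supp :: "'a::topological_space measure \<Rightarrow> 'a set" where
  "supp \<mu> = {x. \<forall>U. open U \<and> x \<in> U \<longrightarrow> 0 < emeasure \<mu> U}"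

text \<open>Only the values of \<open>\<Phi>\<close> on the open unit interval matter. ``Decreases'' is read in the weak
  sense.\<close>

definition dimension_function :: "(real \<Rightarrow> real) \<Rightarrow> bool" where
  "dimension_function \<Phi> \<longleftrightarrow>
     (\<forall>x\<in>{0<..<1}. 0 \<le> \<Phi> x) \<and>
     mono_on {0<..<1} (\<lambda>x. x powr (1 + \<Phi> x)) \<and>
     ((\<lambda>x. x powr (1 + \<Phi> x)) \<longlongrightarrow> 0) (at_right 0)"

text \<open>The pairs \<open>(r, R)\<close> of radii compared by the \<open>\<Phi>\<close>-dimensions at scales up to \<open>C\<close>; the
  condition \<open>R < 1\<close> keeps \<open>R\<close> in the domain of \<open>\<Phi>\<close>.\<close>

definition Phi_scales :: "(real \<Rightarrow> real) \<Rightarrow> real \<Rightarrow> (real \<times> real) set" where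
  "Phi_scales \<Phi> C =
     {(r, R). 0 < r \<and> r < R powr (1 + \<Phi> R) \<and> R powr (1 + \<Phi> R) \<le> R \<and> R \<le> C \<and> 0 < R \<and> R < 1}"

text \<open>Extended reals, so that the infimum and the supremum make sense for every measure.\<close>

definition upper_Phi_dim :: "(real \<Rightarrow> real) \<Rightarrow> 'a::metric_space measure \<Rightarrow> ereal" where
  "upper_Phi_dim \<Phi> \<mu> =
     Inf (ereal ` {\<alpha>. \<exists>C1>0. \<exists>C2>0. \<forall>(r, R)\<in>Phi_scales \<Phi> C1. \<forall>x\<in>supp \<mu>.
       measure \<mu> (ball x R) / measure \<mu> (ball x r) \<le> C2 * (R / r) powr \<alpha>})"

definition lower_Phi_dim :: "(real \<Rightarrow> real) \<Rightarrow> 'a::metric_space measure \<Rightarrow> ereal" where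
  "lower_Phi_dim \<Phi> \<mu> =
     Sup (ereal ` {\<alpha>. \<exists>C1>0. \<exists>C2>0. \<forall>(r, R)\<in>Phi_scales \<Phi> C1. \<forall>x\<in>supp \<mu>.
       measure \<mu> (ball x R) / measure \<mu> (ball x r) \<ge> C2 * (R / r) powr \<alpha>})"

text \<open>\<open>has_local_dim \<mu> z d\<close>: the local dimension of \<open>\<mu>\<close> at \<open>z\<close> exists and equals \<open>d\<close>; an infinite
  limit counts as existing.\<close>

definition has_local_dim :: "'a::metric_space measure \<Rightarrow> 'a \<Rightarrow> ereal \<Rightarrow> bool" where
  "has_local_dim \<mu> z d \<longleftrightarrow>
     ((\<lambda>r. ereal (ln (measure \<mu> (ball z r)) / ln r)) \<longlongrightarrow> d) (at_right 0)"

definition local_dims :: "'a::metric_space measure \<Rightarrow> ereal set" where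
  "local_dims \<mu> = {d. \<exists>z\<in>supp \<mu>. has_local_dim \<mu> z d}"

definition is_minimum :: "'a::order set \<Rightarrow> 'a \<Rightarrow> bool" where
  "is_minimum A a \<longleftrightarrow> a \<in> A \<and> (\<forall>b\<in>A. a \<le> b)"

definition is_maximum :: "'a::order set \<Rightarrow> 'a \<Rightarrow> bool" where
  "is_maximum A a \<longleftrightarrow> a \<in> A \<and> (\<forall>b\<in>A. b \<le> a)"

end

theory Submission
  imports Defs
begin

text \<open>
  Strong separation makes the measure exactly self-similar at small scales. Let \<open>\<delta> > 0\<close> be a lower
  bound for the distances between distinct pieces \<open>S i ` K\<close> and \<open>S j ` K\<close>. A ball of radius
  \<open>\<bar>r j\<bar> * t < \<delta>\<close> about \<open>S j x\<close> with \<open>x \<in> K\<close> meets no other piece, and \<open>\<mu>\<close> lives on \<open>K\<close>, so its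
  mass is \<open>p j\<close> times that of the ball of radius \<open>t\<close> about \<open>x\<close> (\<open>mass_renormalization\<close>). A quotient
  of the masses of two small concentric balls is therefore unchanged when both are magnified by the
  inverse of \<open>S j\<close>, and one can magnify until the larger ball has size comparable with 1.

  Put \<open>s j = ln (p j) / ln \<bar>r j\<bar>\<close>, the exponent with \<open>p j = \<bar>r j\<bar> powr s j\<close>. Magnifying the smaller
  ball further multiplies its mass by factors \<open>1 / p j\<close> while its radius grows by \<open>1 / \<bar>r j\<bar>\<close>. The
  outcome is that the mass quotient of concentric balls of radii \<open>t \<le> R\<close> centred in \<open>K\<close> lies, up to
  constants, between \<open>(R / t) powr s\<close> for the least and for the greatest of the \<open>s j\<close>
  (\<open>mass_ratio_lower_bound\<close>, \<open>mass_ratio_upper_bound\<close>). At the fixed point of a single \<open>S j\<close> only the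
  map \<open>S j\<close> is ever undone, and the quotient is comparable with \<open>(R / t) powr s j\<close> itself.

  All four quantities of the theorem follow. Local dimensions lie between the least and the greatest
  \<open>s j\<close>, and the fixed points realize these two values. The uniform bounds hold for all pairs of radii,
  hence for those that \<open>\<Phi>\<close> admits, which bounds the \<open>\<Phi>\<close>-dimensions on one side. For the other side
  fix one small \<open>R\<close> and let \<open>t\<close> tend to 0 at a fixed point: every sufficiently small \<open>t\<close> is admitted
  whatever \<open>\<Phi>\<close> is, so the exponent \<open>s j\<close> is visible to every \<open>\<Phi>\<close>.
\<close>

section \<open>Compact sets, powers and logarithms\<close>

lemma disjoint_compact_sets_separated:
  fixes A B :: "'a::metric_space set"
  assumes "compact A" "compact B" "A \<inter> B = {}"
  obtains d where "0 < d" "\<And>x y. x \<in> A \<Longrightarrow> y \<in> B \<Longrightarrow> d \<le> dist x y"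
proof (cases "A = {} \<or> B = {}")
  case True
  then show ?thesis using that[of 1] by auto
next
  case False
  have "continuous_on A (\<lambda>x. infdist x B)" by (intro continuous_intros)
  then obtain x0 where x0: "x0 \<in> A" "\<And>x. x \<in> A \<Longrightarrow> infdist x0 B \<le> infdist x B"
    using continuous_attains_inf[of A "\<lambda>x. infdist x B"] assms(1) False by blast
  have "0 < infdist x0 B"
    using infdist_pos_not_in_closed[of B x0] compact_imp_closed assms False x0(1) by blast
  moreover have "infdist x0 B \<le> dist x y" if "x \<in> A" "y \<in> B" for x y
    using x0(2)[OF that(1)] infdist_le[OF that(2), of x] by linarith
  ultimately show ?thesis using that by blast
qed

lemma powr_exponent_le_if_eventually_le:
  fixes A B s \<alpha> :: real
  assumes "0 < A" and ev: "eventually (\<lambda>t. A * t powr s \<le> B * t powr \<alpha>) at_top"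
  shows "s \<le> \<alpha>"
proof (rule ccontr)
  assume "\<not> s \<le> \<alpha>"
  then have "((\<lambda>t::real. B * t powr (\<alpha> - s)) \<longlongrightarrow> B * 0) at_top"
    by (intro tendsto_intros tendsto_neg_powr filterlim_ident) simp
  moreover have "eventually (\<lambda>t. A \<le> B * t powr (\<alpha> - s)) at_top"
    using ev eventually_gt_at_top[of 0]
    by eventually_elim (simp add: powr_diff field_simps)
  ultimately have "A \<le> B * 0"
    by (rule tendsto_lowerbound) simp
  then show False using \<open>0 < A\<close> by simp
qed

text \<open>The logarithmic quotient of a power law \<open>c * t powr s\<close>: the constant \<open>c\<close> is invisible in the
  limit. The two lemmas that follow turn power bounds into bounds by such quotients; the inequalities
  are reversed because \<open>ln t < 0\<close>.\<close>

lemma log_quotient_tendsto: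
  fixes c s :: real
  shows "((\<lambda>t. ereal (s + ln c / ln t)) \<longlongrightarrow> ereal s) (at_right 0)"
proof -
  have "((\<lambda>t::real. s + ln c / ln t) \<longlongrightarrow> s + 0) (at_right 0)"
    by (intro tendsto_intros tendsto_divide_0[OF tendsto_const]
        filterlim_at_bot_imp_at_infinity ln_at_0)
  then show ?thesis by simp
qed

lemma log_quotient_le:
  fixes c t M s :: real
  assumes "0 < c" "0 < t" "t < 1" "c * t powr s \<le> M"
  shows "ln M / ln t \<le> s + ln c / ln t"
proof -
  have "ln (c * t powr s) \<le> ln M"
    using assms by (intro ln_mono) auto
  then have "ln c + s * ln t \<le> ln M"
    using assms by (simp add: ln_mult)
  then have "ln M / ln t \<le> (ln c + s * ln t) / ln t"
    using assms by (intro divide_right_mono_neg) auto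
  then show ?thesis using assms by (simp add: add_divide_distrib)
qed

lemma log_quotient_ge:
  fixes C t M s :: real
  assumes "0 < C" "0 < t" "t < 1" "0 < M" "M \<le> C * t powr s"
  shows "s + ln C / ln t \<le> ln M / ln t"
proof -
  have "ln M \<le> ln (C * t powr s)"
    using assms by (intro ln_mono) auto
  then have "ln M \<le> ln C + s * ln t"
    using assms by (simp add: ln_mult)
  then have "(ln C + s * ln t) / ln t \<le> ln M / ln t"
    using assms by (intro divide_right_mono_neg) auto
  then show ?thesis using assms by (simp add: add_divide_distrib)
qed

lemma eventually_at_right_0_unit: "eventually (\<lambda>t::real. 0 < t \<and> t < 1) (at_right 0)"
  by (auto simp: eventually_at_right_field intro: exI[of _ 1])

lemma has_local_dim_le:
  assumes dim: "has_local_dim \<mu> z d" and "0 < c"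
    and lower: "\<And>t. 0 < t \<Longrightarrow> t \<le> 1 \<Longrightarrow> c * t powr s \<le> measure \<mu> (ball z t)"
  shows "d \<le> ereal s"
proof (rule tendsto_le[OF _ log_quotient_tendsto dim[unfolded has_local_dim_def]])
  show "eventually (\<lambda>t. ereal (ln (measure \<mu> (ball z t)) / ln t) \<le> ereal (s + ln c / ln t)) (at_right 0)"
    using eventually_at_right_0_unit
    by eventually_elim (use lower log_quotient_le[OF \<open>0 < c\<close>] in auto)
qed simp

lemma has_local_dim_ge:
  assumes dim: "has_local_dim \<mu> z d" and "0 < C"
    and pos: "\<And>t. 0 < t \<Longrightarrow> 0 < measure \<mu> (ball z t)"
    and upper: "\<And>t. 0 < t \<Longrightarrow> t \<le> 1 \<Longrightarrow> measure \<mu> (ball z t) \<le> C * t powr s"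
  shows "ereal s \<le> d"
proof (rule tendsto_le[OF _ dim[unfolded has_local_dim_def] log_quotient_tendsto])
  show "eventually (\<lambda>t. ereal (s + ln C / ln t) \<le> ereal (ln (measure \<mu> (ball z t)) / ln t)) (at_right 0)"
    using eventually_at_right_0_unit
    by eventually_elim (use pos upper log_quotient_ge[OF \<open>0 < C\<close>] in auto)
qed simp

lemma has_local_dim_if_power_law:
  assumes "0 < c" "0 < C"
    and lower: "\<And>t. 0 < t \<Longrightarrow> t \<le> 1 \<Longrightarrow> c * t powr s \<le> measure \<mu> (ball z t)"
    and upper: "\<And>t. 0 < t \<Longrightarrow> t \<le> 1 \<Longrightarrow> measure \<mu> (ball z t) \<le> C * t powr s"
  shows "has_local_dim \<mu> z (ereal s)"
  unfolding has_local_dim_def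
proof (rule tendsto_sandwich[OF _ _ log_quotient_tendsto[of s C] log_quotient_tendsto[of s c]])
  have pos: "0 < measure \<mu> (ball z t)" if "0 < t" "t < 1" for t
    using lower[of t] that \<open>0 < c\<close> by (smt (verit) mult_pos_pos powr_gt_zero)
  show "eventually (\<lambda>t. ereal (s + ln C / ln t) \<le> ereal (ln (measure \<mu> (ball z t)) / ln t)) (at_right 0)"
    using eventually_at_right_0_unit
    by eventually_elim (use pos upper log_quotient_ge[OF \<open>0 < C\<close>] in auto)
  show "eventually (\<lambda>t. ereal (ln (measure \<mu> (ball z t)) / ln t) \<le> ereal (s + ln c / ln t)) (at_right 0)"
    using eventually_at_right_0_unit
    by eventually_elim (use lower log_quotient_le[OF \<open>0 < c\<close>] in auto)
qed

section \<open>Renormalization of a separated self-similar measure\<close>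

locale separated_self_similar_measure =
  fixes m :: nat and r p :: "nat \<Rightarrow> real" and S :: "nat \<Rightarrow> 'a::complete_space \<Rightarrow> 'a"
    and K :: "'a set" and \<mu> :: "'a measure"
  assumes ifs: "ifs m r S"
    and weights: "prob_weights m p"
    and self_similar_K: "self_similar_set m S K"
    and self_similar_\<mu>: "self_similar_measure m S p \<mu>"
    and separated: "strong_separation m S K"
begin

lemma ratio_bounds: "j \<le> m \<Longrightarrow> 0 < \<bar>r j\<bar>" "j \<le> m \<Longrightarrow> \<bar>r j\<bar> < 1"
  using ifs by (auto simp: ifs_def)

lemma dist_S: "j \<le> m \<Longrightarrow> dist (S j x) (S j y) = \<bar>r j\<bar> * dist x y"
  using ifs by (auto simp: ifs_def similarity_def)

lemma continuous_S: "j \<le> m \<Longrightarrow> continuous_on A (S j)"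
  by (intro lipschitz_on_continuous_on[of "\<bar>r j\<bar>"] lipschitz_onI) (simp_all add: dist_S)

lemma open_vimage_S: "j \<le> m \<Longrightarrow> open U \<Longrightarrow> open (S j -` U)"
  using continuous_S[of j UNIV] by (simp add: open_vimage)

lemma weight_pos: "j \<le> m \<Longrightarrow> 0 < p j"
  and sum_weights: "(\<Sum>j\<le>m. p j) = 1"
  using weights by (auto simp: prob_weights_def)

lemma weight_less_1:
  assumes "j \<le> m"
  shows "p j < 1"
proof -
  obtain i where i: "i \<le> m" "i \<noteq> j"
    using ifs by (cases "j = 0") (auto simp: ifs_def)
  have "(\<Sum>k\<in>{i, j}. p k) \<le> (\<Sum>k\<le>m. p k)"
    using i assms weight_pos by (intro sum_mono2) (auto intro: less_imp_le)
  with i weight_pos[of i] sum_weights show ?thesis by simp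
qed

lemma K_nonempty: "K \<noteq> {}"
  and K_compact: "compact K"
  and K_eq: "K = (\<Union>j\<le>m. S j ` K)"
  using self_similar_K unfolding self_similar_set_def by blast+

lemma S_in_K: "j \<le> m \<Longrightarrow> x \<in> K \<Longrightarrow> S j x \<in> K"
  using K_eq by blast

lemma K_borel: "K \<in> sets borel"
  using K_compact by (simp add: borel_closed compact_imp_closed)

lemma sets_\<mu>: "sets \<mu> = sets borel"
  and measure_self_similar:
    "E \<in> sets borel \<Longrightarrow> measure \<mu> E = (\<Sum>j\<le>m. p j * measure \<mu> (S j -` E))"
  using self_similar_\<mu> by (auto simp: self_similar_measure_def)

lemma space_\<mu>: "space \<mu> = UNIV"
  using sets_eq_imp_space_eq[OF sets_\<mu>] by simp

sublocale prob_space \<mu>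
  using self_similar_\<mu> by (simp add: self_similar_measure_def)

text \<open>There are finitely many maps, so the contraction is uniform; the lower bound keeps a magnification by
  one map from overshooting the range of scales under consideration.\<close>

lemma uniform_ratio_bounds:
  obtains b \<rho> where "0 < b" "\<rho> < 1" "\<And>j. j \<le> m \<Longrightarrow> b \<le> \<bar>r j\<bar>" "\<And>j. j \<le> m \<Longrightarrow> \<bar>r j\<bar> \<le> \<rho>"
proof
  let ?A = "(\<lambda>j. \<bar>r j\<bar>) ` {..m}"
  have fin: "finite ?A" "?A \<noteq> {}" by auto
  show "0 < Min ?A" "Max ?A < 1"
    using ratio_bounds by (auto simp: Min_gr_iff[OF fin] Max_less_iff[OF fin])
  show "Min ?A \<le> \<bar>r j\<bar>" "\<bar>r j\<bar> \<le> Max ?A" if "j \<le> m" for j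
    using that by auto
qed

text \<open>Each \<open>S j\<close> moves points closer to \<open>K\<close> by the factor \<open>\<rho>\<close>, so by invariance of \<open>\<mu>\<close> the
  \<open>\<rho> * t\<close>-neighbourhood of \<open>K\<close> has at least the mass of its \<open>t\<close>-neighbourhood. Iterating, every
  neighbourhood of \<open>K\<close> has at least the mass of arbitrarily large ones, which exhaust the space.\<close>

lemma measure_K: "measure \<mu> K = 1"
proof -
  obtain \<rho> where \<rho>: "\<rho> < 1" "\<And>j. j \<le> m \<Longrightarrow> \<bar>r j\<bar> \<le> \<rho>"
    using uniform_ratio_bounds by metis
  have "0 < \<rho>" using \<rho>(2)[of 0] ratio_bounds(1)[of 0] by simp
  define N where "N t = {x. infdist x K < t}" for t :: real
  have open_N: "open (N t)" for t
    unfolding N_def by (intro open_Collect_less continuous_intros)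
  then have N_sets: "N t \<in> sets \<mu>" for t by (simp add: sets_\<mu>)
  have contract: "infdist (S j x) K \<le> \<rho> * infdist x K" if "j \<le> m" for j x
  proof -
    have "infdist (S j x) K / \<rho> \<le> dist x y" if "y \<in> K" for y
    proof -
      have "infdist (S j x) K \<le> dist (S j x) (S j y)"
        using \<open>j \<le> m\<close> that by (intro infdist_le S_in_K)
      also have "\<dots> \<le> \<rho> * dist x y"
        using \<rho>(2)[of j] \<open>j \<le> m\<close> by (simp add: dist_S mult_right_mono)
      finally show ?thesis using \<open>0 < \<rho>\<close> by (simp add: field_simps)
    qed
    then have "infdist (S j x) K / \<rho> \<le> infdist x K"
      unfolding infdist_def[of x K] using K_nonempty by (auto intro!: cINF_greatest)
    then show ?thesis using \<open>0 < \<rho>\<close> by (simp add: field_simps)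
  qed
  \<comment> \<open>Weights sum to 1, and every preimage of the smaller neighbourhood contains the larger one.\<close>
  have step: "measure \<mu> (N t) \<le> measure \<mu> (N (\<rho> * t))" for t
  proof -
    have "measure \<mu> (N t) = (\<Sum>j\<le>m. p j * measure \<mu> (N t))"
      by (simp add: sum_weights flip: sum_distrib_right)
    also have "\<dots> \<le> (\<Sum>j\<le>m. p j * measure \<mu> (S j -` N (\<rho> * t)))"
    proof (intro sum_mono mult_left_mono finite_measure_mono)
      fix j assume "j \<in> {..m}"
      then have "j \<le> m" by simp
      show "N t \<subseteq> S j -` N (\<rho> * t)"
      proof
        fix x assume "x \<in> N t"
        then have "\<rho> * infdist x K < \<rho> * t" using \<open>0 < \<rho>\<close> by (simp add: N_def)
        with contract[OF \<open>j \<le> m\<close>, of x] show "x \<in> S j -` N (\<rho> * t)" by (simp add: N_def)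
      qed
      show "S j -` N (\<rho> * t) \<in> sets \<mu>"
        using open_vimage_S[OF \<open>j \<le> m\<close> open_N] by (simp add: sets_\<mu>)
      show "0 \<le> p j" using weight_pos[OF \<open>j \<le> m\<close>] by simp
    qed
    also have "\<dots> = measure \<mu> (N (\<rho> * t))"
      using open_N by (simp add: measure_self_similar)
    finally show ?thesis .
  qed
  have N_full: "measure \<mu> (N t) = 1" if "0 < t" for t
  proof -
    have "measure \<mu> (N (t / \<rho> ^ n)) \<le> measure \<mu> (N t)" for n
    proof (induction n)
      case (Suc n)
      have "\<rho> * (t / \<rho> ^ Suc n) = t / \<rho> ^ n" using \<open>0 < \<rho>\<close> by simp
      with step[of "t / \<rho> ^ Suc n"] Suc show ?case by simp
    qed simp
    moreover have "(\<lambda>n. measure \<mu> (N (t / \<rho> ^ n))) \<longlonglongrightarrow> measure \<mu> (\<Union>n. N (t / \<rho> ^ n))"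
    proof (intro finite_Lim_measure_incseq incseq_SucI)
      fix n
      have "t / \<rho> ^ n \<le> t / \<rho> ^ Suc n"
        using that \<open>0 < \<rho>\<close> \<open>\<rho> < 1\<close> by (intro divide_left_mono power_decreasing) auto
      then show "N (t / \<rho> ^ n) \<subseteq> N (t / \<rho> ^ Suc n)" by (auto simp: N_def)
    qed (use N_sets in auto)
    moreover have "(\<Union>n. N (t / \<rho> ^ n)) = UNIV"
    proof (intro equalityI subset_UNIV subsetI)
      fix x
      have "0 < t / (infdist x K + 1)"
        using that infdist_nonneg[of x K] by (intro divide_pos_pos) linarith+
      then obtain n where "\<rho> ^ n < t / (infdist x K + 1)"
        using real_arch_pow_inv \<open>\<rho> < 1\<close> by blast
      then have "infdist x K + 1 < t / \<rho> ^ n"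
        using \<open>0 < \<rho>\<close> infdist_nonneg[of x K] by (simp add: field_simps)
      then show "x \<in> (\<Union>n. N (t / \<rho> ^ n))" by (auto simp: N_def intro!: exI[of _ n])
    qed
    ultimately have "1 \<le> measure \<mu> (N t)"
      using prob_space by (intro tendsto_upperbound[of _ 1 sequentially]) (auto simp: space_\<mu>)
    then show ?thesis using prob_le_1[of "N t"] by simp
  qed
  have "(\<lambda>n. measure \<mu> (N (inverse (real (Suc n))))) \<longlonglongrightarrow> measure \<mu> (\<Inter>n. N (inverse (real (Suc n))))"
    by (intro finite_Lim_measure_decseq decseq_SucI)
       (use N_sets in \<open>auto simp: N_def intro: less_le_trans le_imp_inverse_le\<close>)
  moreover have "(\<Inter>n. N (inverse (real (Suc n)))) = K"
  proof
    show "K \<subseteq> (\<Inter>n. N (inverse (real (Suc n))))" by (auto simp: N_def)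
    show "(\<Inter>n. N (inverse (real (Suc n)))) \<subseteq> K"
    proof
      fix x assume x: "x \<in> (\<Inter>n. N (inverse (real (Suc n))))"
      have "\<not> 0 < infdist x K"
      proof
        assume "0 < infdist x K"
        then obtain n where "inverse (real (Suc n)) < infdist x K" using reals_Archimedean by blast
        with x show False by (auto simp: N_def dest: less_asym)
      qed
      then show "x \<in> K"
        using infdist_pos_not_in_closed[of K x] K_compact K_nonempty compact_imp_closed by blast
    qed
  qed
  ultimately show ?thesis using N_full by (simp add: LIMSEQ_const_iff)
qed

lemma measure_eq_0_if_disjoint_K:
  assumes "E \<in> sets borel" "E \<inter> K = {}"
  shows "measure \<mu> E = 0"
proof -
  have "measure \<mu> (E \<union> K) = measure \<mu> E + measure \<mu> K"
    using assms K_borel by (intro finite_measure_Union) (auto simp: sets_\<mu>)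
  then show ?thesis using prob_le_1[of "E \<union> K"] measure_K measure_nonneg[of \<mu> E] by simp
qed

lemma uniform_separation:
  obtains \<delta> where "0 < \<delta>"
    "\<And>i j x y. i \<le> m \<Longrightarrow> j \<le> m \<Longrightarrow> i \<noteq> j \<Longrightarrow> x \<in> K \<Longrightarrow> y \<in> K \<Longrightarrow> \<delta> \<le> dist (S i x) (S j y)"
proof -
  have "\<exists>d>0. \<forall>x\<in>K. \<forall>y\<in>K. i \<noteq> j \<longrightarrow> d \<le> dist (S i x) (S j y)" if "i \<le> m" "j \<le> m" for i j
  proof (cases "i = j")
    case False
    have "compact (S i ` K)" "compact (S j ` K)"
      using that continuous_S K_compact by (auto intro: compact_continuous_image)
    moreover have "S i ` K \<inter> S j ` K = {}"
      using separated that False by (auto simp: strong_separation_def disjoint_family_on_def)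
    ultimately show ?thesis
      by (rule disjoint_compact_sets_separated) blast
  qed (auto intro: exI[of _ 1])
  then obtain d where d: "\<And>i j. i \<le> m \<Longrightarrow> j \<le> m \<Longrightarrow> 0 < d i j"
    "\<And>i j x y. i \<le> m \<Longrightarrow> j \<le> m \<Longrightarrow> i \<noteq> j \<Longrightarrow> x \<in> K \<Longrightarrow> y \<in> K \<Longrightarrow> d i j \<le> dist (S i x) (S j y)"
    by metis
  let ?D = "(\<lambda>(i, j). d i j) ` ({..m} \<times> {..m})"
  have fin: "finite ?D" "?D \<noteq> {}" by auto
  show thesis
  proof
    show "0 < Min ?D" using d(1) by (auto simp: Min_gr_iff[OF fin])
    fix i j x y assume *: "i \<le> m" "j \<le> m" "i \<noteq> j" "x \<in> K" "y \<in> K"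
    then have "Min ?D \<le> d i j" by (intro Min_le fin) auto
    with d(2)[OF *] show "Min ?D \<le> dist (S i x) (S j y)" by simp
  qed
qed

abbreviation mass :: "'a \<Rightarrow> real \<Rightarrow> real" where
  "mass x t \<equiv> measure \<mu> (ball x t)"

lemma mass_mono: "t \<le> u \<Longrightarrow> mass x t \<le> mass x u"
  by (intro finite_measure_mono) (auto simp: sets_\<mu>)

lemma vimage_ball_S: "j \<le> m \<Longrightarrow> S j -` ball (S j x) (\<bar>r j\<bar> * t) = ball x t"
  using ratio_bounds[of j] by (auto simp: dist_S)

text \<open>The term of \<open>S j\<close> in the self-similarity equation is exact at every scale, because \<open>S j\<close> is a
  similarity. Discarding the others gives the inequality \<open>mass_S_ge\<close>.\<close>

lemma mass_S_expand:
  assumes "j \<le> m"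
  shows "mass (S j x) (\<bar>r j\<bar> * t) =
    p j * mass x t + (\<Sum>i\<in>{..m} - {j}. p i * measure \<mu> (S i -` ball (S j x) (\<bar>r j\<bar> * t)))"
  using assms by (subst measure_self_similar) (simp_all add: sum.remove[of "{..m}" j] vimage_ball_S)

lemma mass_S_ge:
  assumes "j \<le> m"
  shows "p j * mass x t \<le> mass (S j x) (\<bar>r j\<bar> * t)"
proof -
  have "0 \<le> (\<Sum>i\<in>{..m} - {j}. p i * measure \<mu> (S i -` ball (S j x) (\<bar>r j\<bar> * t)))"
    using weight_pos by (intro sum_nonneg mult_nonneg_nonneg) (auto intro: less_imp_le)
  then show ?thesis using mass_S_expand[OF assms] by simp
qed

text \<open>Below the separation distance the other preimages of the ball miss \<open>K\<close> and hence carry no mass.\<close>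

lemma mass_renormalization:
  obtains \<delta> where "0 < \<delta>"
    "\<And>j x t. j \<le> m \<Longrightarrow> x \<in> K \<Longrightarrow> \<bar>r j\<bar> * t < \<delta> \<Longrightarrow> mass (S j x) (\<bar>r j\<bar> * t) = p j * mass x t"
proof -
  obtain \<delta> where \<delta>: "0 < \<delta>"
    "\<And>i j x y. i \<le> m \<Longrightarrow> j \<le> m \<Longrightarrow> i \<noteq> j \<Longrightarrow> x \<in> K \<Longrightarrow> y \<in> K \<Longrightarrow> \<delta> \<le> dist (S i x) (S j y)"
    by (rule uniform_separation) (rule that; blast)
  have "mass (S j x) (\<bar>r j\<bar> * t) = p j * mass x t" if *: "j \<le> m" "x \<in> K" "\<bar>r j\<bar> * t < \<delta>" for j x t
  proof -
    have "measure \<mu> (S i -` ball (S j x) (\<bar>r j\<bar> * t)) = 0" if i: "i \<in> {..m} - {j}" for i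
    proof (rule measure_eq_0_if_disjoint_K)
      show "S i -` ball (S j x) (\<bar>r j\<bar> * t) \<in> sets borel"
        using i by (intro borel_open open_vimage_S) auto
      show "S i -` ball (S j x) (\<bar>r j\<bar> * t) \<inter> K = {}"
        using \<delta>(2)[of j i x] i * by force
    qed
    then show ?thesis by (simp add: mass_S_expand[OF \<open>j \<le> m\<close>])
  qed
  with \<delta>(1) that show thesis by blast
qed

section \<open>Power bounds by induction over scales\<close>

text \<open>\<open>carried_by Z J\<close> says that every point of \<open>Z\<close> can be magnified by the inverse of some \<open>S j\<close> with
  \<open>j \<in> J\<close> without leaving \<open>Z\<close>. It lets the same estimates apply to all of \<open>K\<close> with all the maps, and
  to a fixed point of one map with that map only, where they are sharp.\<close>

definition carried_by :: "'a set \<Rightarrow> nat set \<Rightarrow> bool" where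
  "carried_by Z J \<longleftrightarrow> J \<subseteq> {..m} \<and> Z \<subseteq> K \<and> Z \<subseteq> (\<Union>j\<in>J. S j ` Z)"

lemma carried_by_K: "carried_by K {..m}"
  using K_eq by (auto simp: carried_by_def)

lemma carried_by_fixed_point:
  assumes "j \<le> m" obtains z where "carried_by {z} {j}"
proof -
  have "\<exists>!z\<in>K. S j z = z"
    using assms ratio_bounds[of j] K_compact K_nonempty
    by (intro Banach_fix[of K "\<bar>r j\<bar>"]) (auto simp: compact_imp_complete dist_S S_in_K)
  then obtain z where "z \<in> K" "S j z = z" by blast
  then have "carried_by {z} {j}" using assms by (simp add: carried_by_def)
  then show thesis by (rule that)
qed

text \<open>Induction over scales: magnifying a ball with centre in \<open>Z\<close> and radius below \<open>\<epsilon>\<close> by the inverse of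
  a suitable \<open>S j\<close> enlarges the radius at least by a fixed factor and keeps the centre in \<open>Z\<close>, so
  finitely many magnifications reach a radius in the base range \<open>[\<epsilon>, T]\<close>. The second assumption on
  \<open>\<epsilon>\<close> makes \<open>T\<close> so large that the base range cannot be jumped over.\<close>

lemma scale_induct [consumes 6, case_names base step]:
  assumes Z: "carried_by Z J" and \<epsilon>: "0 < \<epsilon>" "\<forall>j\<le>m. \<epsilon> \<le> \<bar>r j\<bar> * T"
    and x: "x \<in> Z" "0 < R" "R \<le> T"
    and base: "\<And>x R. x \<in> Z \<Longrightarrow> \<epsilon> \<le> R \<Longrightarrow> R \<le> T \<Longrightarrow> P x R"
    and step: "\<And>j x R. j \<in> J \<Longrightarrow> x \<in> Z \<Longrightarrow> 0 < R \<Longrightarrow> R \<le> T \<Longrightarrow> \<bar>r j\<bar> * R < \<epsilon> \<Longrightarrow> P x R \<Longrightarrow>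
      P (S j x) (\<bar>r j\<bar> * R)"
  shows "P x R"
proof -
  obtain \<rho> where \<rho>: "\<rho> < 1" "\<And>j. j \<le> m \<Longrightarrow> \<bar>r j\<bar> \<le> \<rho>"
    using uniform_ratio_bounds by metis
  have "0 < \<rho>" using \<rho>(2)[of 0] ratio_bounds(1)[of 0] by simp
  have main: "\<rho> ^ n * \<epsilon> \<le> R \<Longrightarrow> x \<in> Z \<Longrightarrow> R \<le> T \<Longrightarrow> P x R" for n x R
  proof (induction n arbitrary: x R)
    case 0
    then show ?case using base by simp
  next
    case (Suc n)
    show ?case
    proof (cases "\<epsilon> \<le> R")
      case True
      then show ?thesis using base Suc.prems by simp
    next
      case False
      from Z Suc.prems(2) obtain j y where j: "j \<in> J" "j \<le> m" "y \<in> Z" "x = S j y"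
        unfolding carried_by_def by blast
      define R' where "R' = R / \<bar>r j\<bar>"
      have R: "R = \<bar>r j\<bar> * R'" using ratio_bounds(1)[OF j(2)] by (simp add: R'_def)
      have "\<bar>r j\<bar> * (\<rho> ^ n * \<epsilon>) \<le> \<rho> * (\<rho> ^ n * \<epsilon>)"
        using \<rho>(2)[OF j(2)] \<open>0 < \<rho>\<close> \<epsilon>(1) by (intro mult_right_mono) auto
      also have "\<dots> \<le> \<bar>r j\<bar> * R'" using Suc.prems(1) R by (simp add: mult.assoc)
      finally have n: "\<rho> ^ n * \<epsilon> \<le> R'" using ratio_bounds(1)[OF j(2)] by simp
      have "\<bar>r j\<bar> * R' \<le> \<bar>r j\<bar> * T" using False R \<epsilon>(2) j(2) by fastforce
      then have T: "R' \<le> T" using ratio_bounds(1)[OF j(2)] by simp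
      have "0 < \<rho> ^ n * \<epsilon>" using \<open>0 < \<rho>\<close> \<epsilon>(1) by simp
      with n have "0 < R'" by linarith
      show ?thesis
        unfolding R j(4)
        using False R by (intro step j \<open>0 < R'\<close> T Suc.IH n) auto
    qed
  qed
  obtain n where "\<rho> ^ n < R / \<epsilon>"
    using real_arch_pow_inv[of "R / \<epsilon>" \<rho>] x \<epsilon>(1) \<rho>(1) by auto
  then show ?thesis using x \<epsilon>(1) by (intro main[of n]) (auto simp: field_simps)
qed

lemma scale_exists:
  obtains T' where "T \<le> T'" "\<forall>j\<le>m. \<epsilon> \<le> \<bar>r j\<bar> * T'"
proof -
  obtain b where b: "0 < b" "\<And>j. j \<le> m \<Longrightarrow> b \<le> \<bar>r j\<bar>" using uniform_ratio_bounds by metis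
  define T' where "T' = max T (\<bar>\<epsilon>\<bar> / b)"
  have T': "\<bar>\<epsilon>\<bar> / b \<le> T'" by (simp add: T'_def)
  have "\<epsilon> \<le> \<bar>r j\<bar> * T'" if "j \<le> m" for j
  proof -
    have "\<epsilon> \<le> b * (\<bar>\<epsilon>\<bar> / b)" using b(1) by simp
    also have "\<dots> \<le> \<bar>r j\<bar> * T'" using b(1) b(2)[OF that] T' by (intro mult_mono) auto
    finally show ?thesis .
  qed
  then show thesis by (intro that[of T']) (auto simp: T'_def)
qed

text \<open>The base range starts at a number \<open>D\<close> exceeding the diameter of \<open>K\<close>: such balls have full mass.
  Each step costs \<open>p j\<close> in mass and \<open>\<bar>r j\<bar> powr s\<close> in the bound.\<close>

lemma mass_lower_bound:
  assumes Z: "carried_by Z J" and s: "0 \<le> s" "\<And>j. j \<in> J \<Longrightarrow> \<bar>r j\<bar> powr s \<le> p j"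
  obtains c where "0 < c" "\<And>x t. x \<in> Z \<Longrightarrow> 0 < t \<Longrightarrow> t \<le> T \<Longrightarrow> c * t powr s \<le> mass x t"
proof -
  obtain D where D: "0 < D" "\<And>x y. x \<in> K \<Longrightarrow> y \<in> K \<Longrightarrow> dist x y < D"
  proof -
    obtain e where "\<And>x y. x \<in> K \<Longrightarrow> y \<in> K \<Longrightarrow> dist x y \<le> e"
      using compact_imp_bounded[OF K_compact] bounded_two_points by metis
    then have "dist x y < \<bar>e\<bar> + 1" if "x \<in> K" "y \<in> K" for x y using that by fastforce
    then show thesis by (intro that[of "\<bar>e\<bar> + 1"]) auto
  qed
  obtain T' where T': "max T 1 \<le> T'" "\<forall>j\<le>m. D \<le> \<bar>r j\<bar> * T'"
    using scale_exists by metis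
  show thesis
  proof
    show "0 < 1 / T' powr s" using T'(1) by simp
    fix x t assume "x \<in> Z" "0 < t" "t \<le> T"
    then have "t \<le> T'" using T'(1) by simp
    with Z D(1) T'(2) \<open>x \<in> Z\<close> \<open>0 < t\<close>
    show "1 / T' powr s * t powr s \<le> mass x t"
    proof (induction rule: scale_induct)
      case (base x R)
      have "K \<subseteq> ball x R" using base D(2) Z by (force simp: carried_by_def)
      then have "measure \<mu> K \<le> mass x R" by (intro finite_measure_mono) (auto simp: sets_\<mu>)
      moreover have "R powr s \<le> T' powr s" using base D(1) s(1) by (intro powr_mono2) auto
      ultimately have "R powr s \<le> T' powr s * mass x R"
        using measure_K mult_left_mono[of 1 "mass x R" "T' powr s"] by simp
      then show ?case using T'(1) by (simp add: field_simps)
    next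
      case (step j x R)
      have j: "j \<le> m" using Z step by (auto simp: carried_by_def)
      have "1 / T' powr s * (\<bar>r j\<bar> * R) powr s = \<bar>r j\<bar> powr s * (1 / T' powr s * R powr s)"
        using step by (simp add: powr_mult)
      also have "\<dots> \<le> p j * mass x R"
        using step s(2)[of j] weight_pos[OF j] by (intro mult_mono) auto
      also have "\<dots> \<le> mass (S j x) (\<bar>r j\<bar> * R)" by (rule mass_S_ge[OF j])
      finally show ?case .
    qed
  qed
qed

text \<open>Here the step needs the equality of \<open>mass_renormalization\<close>, so the base range starts at the
  separation scale \<open>\<delta>\<close>, where the mass is estimated by 1.\<close>

lemma mass_upper_bound:
  assumes Z: "carried_by Z J" and s: "0 \<le> s" "\<And>j. j \<in> J \<Longrightarrow> p j \<le> \<bar>r j\<bar> powr s"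
  obtains C where "0 < C" "\<And>x t. x \<in> Z \<Longrightarrow> 0 < t \<Longrightarrow> t \<le> T \<Longrightarrow> mass x t \<le> C * t powr s"
proof -
  obtain \<delta> where \<delta>: "0 < \<delta>"
    "\<And>j x t. j \<le> m \<Longrightarrow> x \<in> K \<Longrightarrow> \<bar>r j\<bar> * t < \<delta> \<Longrightarrow> mass (S j x) (\<bar>r j\<bar> * t) = p j * mass x t"
    by (rule mass_renormalization) (rule that; blast)
  obtain T' where T': "T \<le> T'" "\<forall>j\<le>m. \<delta> \<le> \<bar>r j\<bar> * T'"
    using scale_exists by metis
  show thesis
  proof
    show "0 < 1 / \<delta> powr s" using \<delta>(1) by simp
    fix x t assume "x \<in> Z" "0 < t" "t \<le> T"
    then have "t \<le> T'" using T'(1) by simp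
    with Z \<delta>(1) T'(2) \<open>x \<in> Z\<close> \<open>0 < t\<close>
    show "mass x t \<le> 1 / \<delta> powr s * t powr s"
    proof (induction rule: scale_induct)
      case (base x R)
      have "\<delta> powr s \<le> R powr s" using base \<delta>(1) s(1) by (intro powr_mono2) auto
      then have "1 \<le> 1 / \<delta> powr s * R powr s" using \<delta>(1) by (simp add: field_simps)
      then show ?case by (rule order_trans[OF prob_le_1])
    next
      case (step j x R)
      have j: "j \<le> m" "x \<in> K" using Z step by (auto simp: carried_by_def)
      have "mass (S j x) (\<bar>r j\<bar> * R) = p j * mass x R" by (rule \<delta>(2)) (use j step in auto)
      also have "\<dots> \<le> \<bar>r j\<bar> powr s * (1 / \<delta> powr s * R powr s)"
        using step s(2)[of j] by (intro mult_mono) auto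
      also have "\<dots> = 1 / \<delta> powr s * (\<bar>r j\<bar> * R) powr s"
        using step by (simp add: powr_mult)
      finally show ?case .
    qed
  qed
qed

text \<open>The dimension \<open>s\<close> for which the piece \<open>S j ` K\<close> has mass \<open>\<bar>r j\<bar> powr s\<close>.\<close>

definition cylinder_dim :: "nat \<Rightarrow> real" where
  "cylinder_dim j = ln (p j) / ln \<bar>r j\<bar>"

lemma cylinder_dim_pos: "j \<le> m \<Longrightarrow> 0 < cylinder_dim j"
  using ratio_bounds[of j] weight_pos[of j] weight_less_1[of j]
  by (simp add: cylinder_dim_def divide_neg_neg)

lemma ratio_powr_cylinder_dim: "j \<le> m \<Longrightarrow> \<bar>r j\<bar> powr cylinder_dim j = p j"
  using ratio_bounds[of j] weight_pos[of j] by (simp add: cylinder_dim_def powr_def)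

lemma ratio_powr_le_weight: "j \<le> m \<Longrightarrow> cylinder_dim j \<le> s \<Longrightarrow> \<bar>r j\<bar> powr s \<le> p j"
  using ratio_bounds[of j] powr_mono'[of "cylinder_dim j" s "\<bar>r j\<bar>"] ratio_powr_cylinder_dim[of j] by simp

lemma weight_le_ratio_powr: "j \<le> m \<Longrightarrow> s \<le> cylinder_dim j \<Longrightarrow> p j \<le> \<bar>r j\<bar> powr s"
  using ratio_bounds[of j] powr_mono'[of s "cylinder_dim j" "\<bar>r j\<bar>"] ratio_powr_cylinder_dim[of j] by simp

definition min_dim :: real where "min_dim = Min (cylinder_dim ` {..m})"
definition max_dim :: real where "max_dim = Max (cylinder_dim ` {..m})"

lemma min_dim_le: "j \<le> m \<Longrightarrow> min_dim \<le> cylinder_dim j"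
  and le_max_dim: "j \<le> m \<Longrightarrow> cylinder_dim j \<le> max_dim"
  by (auto simp: min_dim_def max_dim_def)

lemma min_dim_attained: obtains j where "j \<le> m" "cylinder_dim j = min_dim"
proof -
  have "min_dim \<in> cylinder_dim ` {..m}" unfolding min_dim_def by (intro Min_in) auto
  then show thesis using that by auto
qed

lemma max_dim_attained: obtains j where "j \<le> m" "cylinder_dim j = max_dim"
proof -
  have "max_dim \<in> cylinder_dim ` {..m}" unfolding max_dim_def by (intro Max_in) auto
  then show thesis using that by auto
qed

lemma min_dim_pos: "0 < min_dim"
proof -
  obtain j where "j \<le> m" "cylinder_dim j = min_dim" by (rule min_dim_attained)
  then show ?thesis using cylinder_dim_pos[of j] by simp
qed

lemma max_dim_pos: "0 < max_dim"
proof -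
  obtain j where "j \<le> m" "cylinder_dim j = max_dim" by (rule max_dim_attained)
  then show ?thesis using cylinder_dim_pos[of j] by simp
qed

lemma uniform_mass_lower_bound:
  obtains c where "0 < c" "\<And>x t. x \<in> K \<Longrightarrow> 0 < t \<Longrightarrow> t \<le> T \<Longrightarrow> c * t powr max_dim \<le> mass x t"
  by (rule mass_lower_bound[OF carried_by_K, of max_dim T])
    (use max_dim_pos ratio_powr_le_weight le_max_dim in auto)

lemma mass_pos:
  assumes "x \<in> K" "0 < t"
  shows "0 < mass x t"
proof -
  obtain c where "0 < c" "c * t powr max_dim \<le> mass x t"
    using uniform_mass_lower_bound[of t] assms by (metis order_refl)
  moreover have "0 < c * t powr max_dim" using \<open>0 < c\<close> assms by simp
  ultimately show ?thesis by linarith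
qed

lemma supp_eq_K: "supp \<mu> = K"
proof
  show "supp \<mu> \<subseteq> K"
  proof
    fix x assume x: "x \<in> supp \<mu>"
    have "measure \<mu> (- K) = 0"
      using K_borel by (intro measure_eq_0_if_disjoint_K) auto
    moreover have "open (- K)" using K_compact compact_imp_closed by blast
    ultimately show "x \<in> K" using x by (auto simp: supp_def emeasure_eq_measure)
  qed
  show "K \<subseteq> supp \<mu>"
  proof
    fix x assume "x \<in> K"
    show "x \<in> supp \<mu>"
      unfolding supp_def
    proof (intro CollectI allI impI)
      fix U assume U: "open U \<and> x \<in> U"
      then obtain e where e: "0 < e" "ball x e \<subseteq> U" using openE by blast
      then have "mass x e \<le> measure \<mu> U" using U by (intro finite_measure_mono) (auto simp: sets_\<mu>)
      with mass_pos[OF \<open>x \<in> K\<close> e(1)] show "0 < emeasure \<mu> U" by (simp add: emeasure_eq_measure)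
    qed
  qed
qed

text \<open>Both masses are multiplied by the same \<open>p j\<close> under renormalization, so induction over the scale of
  the larger radius reduces the quotient to the case where that radius is at least \<open>\<delta>\<close>. There the
  numerator is at most 1, and the denominator is controlled by \<open>mass_lower_bound\<close>.\<close>

lemma mass_ratio_upper_bound:
  assumes Z: "carried_by Z J" and s: "0 \<le> s" "\<And>j. j \<in> J \<Longrightarrow> \<bar>r j\<bar> powr s \<le> p j"
  obtains B where "0 < B"
    "\<And>x t R. x \<in> Z \<Longrightarrow> 0 < t \<Longrightarrow> t \<le> R \<Longrightarrow> R \<le> T \<Longrightarrow> mass x R / mass x t \<le> B * (R / t) powr s"
proof -
  obtain \<delta> where \<delta>: "0 < \<delta>"
    "\<And>j x t. j \<le> m \<Longrightarrow> x \<in> K \<Longrightarrow> \<bar>r j\<bar> * t < \<delta> \<Longrightarrow> mass (S j x) (\<bar>r j\<bar> * t) = p j * mass x t"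
    by (rule mass_renormalization) (rule that; blast)
  obtain T' where T': "T \<le> T'" "\<forall>j\<le>m. \<delta> \<le> \<bar>r j\<bar> * T'"
    using scale_exists by metis
  obtain c where c: "0 < c" "\<And>x t. x \<in> Z \<Longrightarrow> 0 < t \<Longrightarrow> t \<le> T' \<Longrightarrow> c * t powr s \<le> mass x t"
    using mass_lower_bound[OF Z s] by metis
  define B where "B = 1 / (c * \<delta> powr s)"
  have "0 < B" using c(1) \<delta>(1) by (simp add: B_def)
  have bound: "\<forall>t. 0 < t \<and> t \<le> R \<longrightarrow> mass x R / mass x t \<le> B * (R / t) powr s"
    if "x \<in> Z" "0 < R" "R \<le> T'" for x R
    using Z \<delta>(1) T'(2) that
  proof (induction rule: scale_induct)
    case (base x R)
    show ?case
    proof (intro allI impI)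
      fix t assume t: "0 < t \<and> t \<le> R"
      have "mass x R / mass x t \<le> 1 / (c * t powr s)"
        using t base c by (intro frac_le) auto
      also have "\<dots> = B * (\<delta> / t) powr s"
        using t \<delta>(1) by (simp add: B_def powr_divide)
      also have "\<dots> \<le> B * (R / t) powr s"
        using t base \<delta>(1) \<open>0 < B\<close> s(1) by (intro mult_left_mono powr_mono2 divide_right_mono) auto
      finally show "mass x R / mass x t \<le> B * (R / t) powr s" .
    qed
  next
    case (step j x R)
    have j: "j \<le> m" "x \<in> K" using Z step by (auto simp: carried_by_def)
    show ?case
    proof (intro allI impI)
      fix t assume t: "0 < t \<and> t \<le> \<bar>r j\<bar> * R"
      define u where "u = t / \<bar>r j\<bar>"
      have u: "t = \<bar>r j\<bar> * u" "0 < u" "u \<le> R"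
        using t ratio_bounds(1)[OF j(1)] by (auto simp: u_def field_simps)
      have "mass (S j x) (\<bar>r j\<bar> * R) = p j * mass x R" "mass (S j x) t = p j * mass x u"
        using \<delta>(2)[OF j, of R] \<delta>(2)[OF j, of u] step t u(1) by auto
      then show "mass (S j x) (\<bar>r j\<bar> * R) / mass (S j x) t \<le> B * (\<bar>r j\<bar> * R / t) powr s"
        using step u weight_pos[OF j(1)] ratio_bounds(1)[OF j(1)] by simp
    qed
  qed
  show thesis
    using that[OF \<open>0 < B\<close>] bound T'(1) by (meson less_le_trans order_trans)
qed

text \<open>The same reduction. In the base case the numerator is at least the mass of a ball of radius \<open>\<delta>\<close>,
  which is bounded below uniformly over \<open>K\<close>; \<open>mass_upper_bound\<close> controls the denominator.\<close>

lemma mass_ratio_lower_bound: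
  assumes Z: "carried_by Z J" and s: "0 \<le> s" "\<And>j. j \<in> J \<Longrightarrow> p j \<le> \<bar>r j\<bar> powr s"
  obtains A where "0 < A"
    "\<And>x t R. x \<in> Z \<Longrightarrow> 0 < t \<Longrightarrow> t \<le> R \<Longrightarrow> R \<le> T \<Longrightarrow> A * (R / t) powr s \<le> mass x R / mass x t"
proof -
  obtain \<delta> where \<delta>: "0 < \<delta>"
    "\<And>j x t. j \<le> m \<Longrightarrow> x \<in> K \<Longrightarrow> \<bar>r j\<bar> * t < \<delta> \<Longrightarrow> mass (S j x) (\<bar>r j\<bar> * t) = p j * mass x t"
    by (rule mass_renormalization) (rule that; blast)
  obtain T' where T': "T \<le> T'" "\<forall>j\<le>m. \<delta> \<le> \<bar>r j\<bar> * T'"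
    using scale_exists by metis
  obtain C where C: "0 < C" "\<And>x t. x \<in> Z \<Longrightarrow> 0 < t \<Longrightarrow> t \<le> T' \<Longrightarrow> mass x t \<le> C * t powr s"
    using mass_upper_bound[OF Z s] by metis
  obtain c where c: "0 < c" "\<And>x t. x \<in> K \<Longrightarrow> 0 < t \<Longrightarrow> t \<le> \<delta> \<Longrightarrow> c * t powr max_dim \<le> mass x t"
    using uniform_mass_lower_bound by metis
  have "0 < T'" using T'(2)[rule_format, of 0] \<delta>(1) ratio_bounds(1)[of 0] less_le_trans zero_less_mult_pos by blast
  define c' where "c' = c * \<delta> powr max_dim"
  have "0 < c'" using c(1) \<delta>(1) by (simp add: c'_def)
  define A where "A = c' / (C * T' powr s)"
  have "0 < A" using \<open>0 < c'\<close> \<open>0 < C\<close> \<open>0 < T'\<close> by (simp add: A_def)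
  have bound: "\<forall>t. 0 < t \<and> t \<le> R \<longrightarrow> A * (R / t) powr s \<le> mass x R / mass x t"
    if "x \<in> Z" "0 < R" "R \<le> T'" for x R
    using Z \<delta>(1) T'(2) that
  proof (induction rule: scale_induct)
    case (base x R)
    have "x \<in> K" using Z base by (auto simp: carried_by_def)
    show ?case
    proof (intro allI impI)
      fix t assume t: "0 < t \<and> t \<le> R"
      have "A * (R / t) powr s \<le> A * (T' / t) powr s"
        using t base \<delta>(1) \<open>0 < A\<close> s(1) by (intro mult_left_mono powr_mono2 divide_right_mono) auto
      also have "\<dots> = c' / (C * t powr s)"
        using t \<open>0 < T'\<close> by (simp add: A_def powr_divide)
      also have "\<dots> \<le> mass x R / mass x t"
      proof (intro frac_le)
        show "c' \<le> mass x R"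
          using c(2)[OF \<open>x \<in> K\<close> \<delta>(1)] mass_mono[of \<delta> R x] base by (simp add: c'_def)
      qed (use t base C mass_pos \<open>x \<in> K\<close> in auto)
      finally show "A * (R / t) powr s \<le> mass x R / mass x t" .
    qed
  next
    case (step j x R)
    have j: "j \<le> m" "x \<in> K" using Z step by (auto simp: carried_by_def)
    show ?case
    proof (intro allI impI)
      fix t assume t: "0 < t \<and> t \<le> \<bar>r j\<bar> * R"
      define u where "u = t / \<bar>r j\<bar>"
      have u: "t = \<bar>r j\<bar> * u" "0 < u" "u \<le> R"
        using t ratio_bounds(1)[OF j(1)] by (auto simp: u_def field_simps)
      have "mass (S j x) (\<bar>r j\<bar> * R) = p j * mass x R" "mass (S j x) t = p j * mass x u"
        using \<delta>(2)[OF j, of R] \<delta>(2)[OF j, of u] step t u(1) by auto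
      then show "A * (\<bar>r j\<bar> * R / t) powr s \<le> mass (S j x) (\<bar>r j\<bar> * R) / mass (S j x) t"
        using step u weight_pos[OF j(1)] ratio_bounds(1)[OF j(1)] by simp
    qed
  qed
  show thesis
    using that[OF \<open>0 < A\<close>] bound T'(1) by (meson less_le_trans order_trans)
qed

lemma Inf_ereal_image_eq_least:
  "a \<in> A \<Longrightarrow> (\<And>\<alpha>. \<alpha> \<in> A \<Longrightarrow> a \<le> \<alpha>) \<Longrightarrow> Inf (ereal ` A) = ereal a"
  by (intro antisym Inf_lower Inf_greatest) auto

lemma Sup_ereal_image_eq_greatest:
  "a \<in> A \<Longrightarrow> (\<And>\<alpha>. \<alpha> \<in> A \<Longrightarrow> \<alpha> \<le> a) \<Longrightarrow> Sup (ereal ` A) = ereal a"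
  by (intro antisym Sup_upper Sup_least) auto

section \<open>Local dimensions and \<open>\<Phi>\<close>-dimensions\<close>

lemma local_dims_bounds:
  assumes "d \<in> local_dims \<mu>"
  shows "ereal min_dim \<le> d" "d \<le> ereal max_dim"
proof -
  from assms obtain z where z: "z \<in> K" "has_local_dim \<mu> z d"
    by (auto simp: local_dims_def supp_eq_K)
  show "d \<le> ereal max_dim"
    by (rule uniform_mass_lower_bound[of 1]) (use z has_local_dim_le in blast)
  show "ereal min_dim \<le> d"
  proof (rule mass_upper_bound[OF carried_by_K, of min_dim 1])
    show "0 \<le> min_dim" using min_dim_pos by simp
    show "p j \<le> \<bar>r j\<bar> powr min_dim" if "j \<in> {..m}" for j
      using that weight_le_ratio_powr min_dim_le by simp
  qed (use z has_local_dim_ge mass_pos in blast)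
qed

lemma cylinder_dim_in_local_dims:
  assumes "j \<le> m"
  shows "ereal (cylinder_dim j) \<in> local_dims \<mu>"
proof -
  obtain z where z: "carried_by {z} {j}" by (rule carried_by_fixed_point[OF assms])
  have s: "0 \<le> cylinder_dim j" "\<bar>r j\<bar> powr cylinder_dim j = p j"
    using assms cylinder_dim_pos[of j] ratio_powr_cylinder_dim by auto
  obtain c where c: "0 < c" "\<And>t. 0 < t \<Longrightarrow> t \<le> 1 \<Longrightarrow> c * t powr cylinder_dim j \<le> mass z t"
    using mass_lower_bound[OF z, of "cylinder_dim j" 1] s by (metis order_refl singletonD singletonI)
  obtain C where C: "0 < C" "\<And>t. 0 < t \<Longrightarrow> t \<le> 1 \<Longrightarrow> mass z t \<le> C * t powr cylinder_dim j"
    using mass_upper_bound[OF z, of "cylinder_dim j" 1] s by (metis order_refl singletonD singletonI)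
  have "has_local_dim \<mu> z (ereal (cylinder_dim j))"
    by (rule has_local_dim_if_power_law[OF c(1) C(1) c(2) C(2)])
  moreover have "z \<in> supp \<mu>" using z by (simp add: supp_eq_K carried_by_def)
  ultimately show ?thesis by (auto simp: local_dims_def)
qed

lemma Phi_scales_bounds:
  assumes "(t, R) \<in> Phi_scales \<Phi> C"
  shows "0 < t" "t \<le> R" "R \<le> C"
  using assms by (auto simp: Phi_scales_def)

text \<open>For one fixed \<open>R\<close> the threshold \<open>R powr (1 + \<Phi> R)\<close> is a positive number, so all large quotients
  \<open>q = R / t\<close> are admitted. This is why the \<open>\<Phi>\<close>-dimensions do not depend on \<open>\<Phi>\<close>.\<close>

lemma eventually_Phi_scales:
  assumes "dimension_function \<Phi>" "0 < R" "R < 1" "R \<le> C"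
  shows "eventually (\<lambda>q. 0 < q \<and> (R / q, R) \<in> Phi_scales \<Phi> C) at_top"
proof -
  have "0 \<le> \<Phi> R" using assms by (simp add: dimension_function_def)
  then have le: "R powr (1 + \<Phi> R) \<le> R"
    using powr_mono'[of 1 "1 + \<Phi> R" R] assms by simp
  show ?thesis
    using eventually_gt_at_top[of "R / R powr (1 + \<Phi> R)"] eventually_gt_at_top[of 0]
    by eventually_elim (use le assms in \<open>auto simp: Phi_scales_def field_simps\<close>)
qed

text \<open>The uniform quotient bound shows that \<open>max_dim\<close> is an admissible exponent. Conversely, at the fixed
  point of a map with the greatest \<open>cylinder_dim\<close> the quotient grows like \<open>q powr max_dim\<close> as
  \<open>q \<rightarrow> \<infinity>\<close>, so no smaller exponent is admissible.\<close>

lemma upper_Phi_dim_eq: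
  assumes \<Phi>: "dimension_function \<Phi>"
  shows "upper_Phi_dim \<Phi> \<mu> = ereal max_dim"
proof -
  let ?A = "{\<alpha>. \<exists>C1>0. \<exists>C2>0. \<forall>(t, R)\<in>Phi_scales \<Phi> C1. \<forall>x\<in>supp \<mu>.
       mass x R / mass x t \<le> C2 * (R / t) powr \<alpha>}"
  have "max_dim \<in> ?A"
  proof (rule mass_ratio_upper_bound[OF carried_by_K, of max_dim 1])
    fix B assume "0 < B" "\<And>x t R. x \<in> K \<Longrightarrow> 0 < t \<Longrightarrow> t \<le> R \<Longrightarrow> R \<le> 1 \<Longrightarrow>
      mass x R / mass x t \<le> B * (R / t) powr max_dim"
    then have "\<forall>(t, R)\<in>Phi_scales \<Phi> 1. \<forall>x\<in>supp \<mu>. mass x R / mass x t \<le> B * (R / t) powr max_dim"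
      by (auto simp: supp_eq_K dest: Phi_scales_bounds)
    then show ?thesis
      unfolding mem_Collect_eq using \<open>0 < B\<close> zero_less_one by blast
  qed (use max_dim_pos ratio_powr_le_weight le_max_dim in auto)
  moreover have "max_dim \<le> \<alpha>" if "\<alpha> \<in> ?A" for \<alpha>
  proof -
    from that obtain C1 C2 where C: "0 < C1" "0 < C2"
      "\<And>t R x. (t, R) \<in> Phi_scales \<Phi> C1 \<Longrightarrow> x \<in> K \<Longrightarrow> mass x R / mass x t \<le> C2 * (R / t) powr \<alpha>"
      by (fastforce simp: supp_eq_K)
    \<comment> \<open>Any radius below \<open>C1\<close> and inside the domain \<open>(0, 1)\<close> of \<open>\<Phi>\<close> serves.\<close>
    define R where "R = min C1 (1 / 2)"
    have R: "0 < R" "R < 1" "R \<le> C1" using C(1) by (auto simp: R_def)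
    obtain j where j: "j \<le> m" "cylinder_dim j = max_dim" by (rule max_dim_attained)
    obtain z where z: "carried_by {z} {j}" by (rule carried_by_fixed_point[OF j(1)])
    then have "z \<in> K" by (simp add: carried_by_def)
    obtain A where A: "0 < A"
      "\<And>t. 0 < t \<Longrightarrow> t \<le> R \<Longrightarrow> A * (R / t) powr max_dim \<le> mass z R / mass z t"
      using mass_ratio_lower_bound[OF z, of max_dim R] j max_dim_pos ratio_powr_cylinder_dim[of j]
      by (metis less_imp_le order_refl singletonD singletonI)
    have "eventually (\<lambda>q. A * q powr max_dim \<le> C2 * q powr \<alpha>) at_top"
      using eventually_Phi_scales[OF \<Phi> R]
    proof eventually_elim
      case (elim q)
      then show ?case
        using A(2)[of "R / q"] C(3)[of "R / q" R z] \<open>z \<in> K\<close> R(1) Phi_scales_bounds[of "R / q" R \<Phi> C1] by simp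
    qed
    with A(1) show ?thesis by (rule powr_exponent_le_if_eventually_le)
  qed
  ultimately show ?thesis
    unfolding upper_Phi_dim_def by (rule Inf_ereal_image_eq_least)
qed

lemma lower_Phi_dim_eq:
  assumes \<Phi>: "dimension_function \<Phi>"
  shows "lower_Phi_dim \<Phi> \<mu> = ereal min_dim"
proof -
  let ?A = "{\<alpha>. \<exists>C1>0. \<exists>C2>0. \<forall>(t, R)\<in>Phi_scales \<Phi> C1. \<forall>x\<in>supp \<mu>.
       mass x R / mass x t \<ge> C2 * (R / t) powr \<alpha>}"
  have "min_dim \<in> ?A"
  proof (rule mass_ratio_lower_bound[OF carried_by_K, of min_dim 1])
    fix A assume "0 < A" "\<And>x t R. x \<in> K \<Longrightarrow> 0 < t \<Longrightarrow> t \<le> R \<Longrightarrow> R \<le> 1 \<Longrightarrow>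
      A * (R / t) powr min_dim \<le> mass x R / mass x t"
    then have "\<forall>(t, R)\<in>Phi_scales \<Phi> 1. \<forall>x\<in>supp \<mu>. mass x R / mass x t \<ge> A * (R / t) powr min_dim"
      by (auto simp: supp_eq_K dest: Phi_scales_bounds)
    then show ?thesis
      unfolding mem_Collect_eq using \<open>0 < A\<close> zero_less_one by blast
  qed (use min_dim_pos weight_le_ratio_powr min_dim_le in auto)
  moreover have "\<alpha> \<le> min_dim" if "\<alpha> \<in> ?A" for \<alpha>
  proof -
    from that obtain C1 C2 where C: "0 < C1" "0 < C2"
      "\<And>t R x. (t, R) \<in> Phi_scales \<Phi> C1 \<Longrightarrow> x \<in> K \<Longrightarrow> C2 * (R / t) powr \<alpha> \<le> mass x R / mass x t"
      by (fastforce simp: supp_eq_K)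
    \<comment> \<open>Any radius below \<open>C1\<close> and inside the domain \<open>(0, 1)\<close> of \<open>\<Phi>\<close> serves.\<close>
    define R where "R = min C1 (1 / 2)"
    have R: "0 < R" "R < 1" "R \<le> C1" using C(1) by (auto simp: R_def)
    obtain j where j: "j \<le> m" "cylinder_dim j = min_dim" by (rule min_dim_attained)
    obtain z where z: "carried_by {z} {j}" by (rule carried_by_fixed_point[OF j(1)])
    then have "z \<in> K" by (simp add: carried_by_def)
    obtain B where B: "0 < B"
      "\<And>t. 0 < t \<Longrightarrow> t \<le> R \<Longrightarrow> mass z R / mass z t \<le> B * (R / t) powr min_dim"
      using mass_ratio_upper_bound[OF z, of min_dim R] j min_dim_pos ratio_powr_cylinder_dim[of j]
      by (metis less_imp_le order_refl singletonD singletonI)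
    have "eventually (\<lambda>q. C2 * q powr \<alpha> \<le> B * q powr min_dim) at_top"
      using eventually_Phi_scales[OF \<Phi> R]
    proof eventually_elim
      case (elim q)
      then show ?case
        using B(2)[of "R / q"] C(3)[of "R / q" R z] \<open>z \<in> K\<close> R(1) Phi_scales_bounds[of "R / q" R \<Phi> C1] by simp
    qed
    with C(2) show ?thesis by (rule powr_exponent_le_if_eventually_le)
  qed
  ultimately show ?thesis
    unfolding lower_Phi_dim_def by (rule Sup_ereal_image_eq_greatest)
qed

end

theorem theorem3p2:
  fixes S :: "nat \<Rightarrow> 'a::complete_space \<Rightarrow> 'a"
    and r p :: "nat \<Rightarrow> real"
    and m :: nat
    and K :: "'a set"
    and \<mu> :: "'a measure"
    and \<Phi> :: "real \<Rightarrow> real"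
  assumes "ifs m r S"
    and "prob_weights m p"
    and "self_similar_set m S K"
    and "self_similar_measure m S p \<mu>"
    and "strong_separation m S K"
    and "dimension_function \<Phi>"
  shows "is_minimum (local_dims \<mu>) (lower_Phi_dim \<Phi> \<mu>) \<and>
         is_maximum (local_dims \<mu>) (upper_Phi_dim \<Phi> \<mu>)"
proof -
  interpret separated_self_similar_measure m r p S K \<mu>
    using assms(1-5) by unfold_locales
  obtain i where "i \<le> m" "cylinder_dim i = min_dim" by (rule min_dim_attained)
  then have "ereal min_dim \<in> local_dims \<mu>" using cylinder_dim_in_local_dims by metis
  moreover obtain j where "j \<le> m" "cylinder_dim j = max_dim" by (rule max_dim_attained)
  then have "ereal max_dim \<in> local_dims \<mu>" using cylinder_dim_in_local_dims by metis
  ultimately show ?thesis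
    using local_dims_bounds lower_Phi_dim_eq[OF assms(6)] upper_Phi_dim_eq[OF assms(6)]
    by (auto simp: is_minimum_def is_maximum_def)
qed

end
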